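(* The FSR INDECOMPOSABILITY problem is NP-hard: the (NP-complete) CIRCUIT SATISFIABILITY problem is polynomial-time Karp reducible to the problem whose instances are feedback shift registers $f$, given by their feedback logic $f_1$ as a Boolean circuit (input size $|f_1|$), and whose question is "Is $f$ indecomposable?".
   Context: A Boolean circuit with $m$ inputs is a directed acyclic graph with $m$ sources (the inputs) and one sink (the output), each non-source vertex being a gate AND or OR (fan-in 2) or NOT (fan-in 1); its size $|f|$ is its number of vertices. It is satisfiable if some input makes it output 1. CIRCUIT SATISFIABILITY: given a Boolean circuit, decide whether it is satisfiable. An $n$-stage feedback shift register (FSR) with feedback logic $f_1:\{0,1\}^n\to\{0,1\}$ has state $(x_0,\dots,x_{n-1})$ updated by $(x_0,\dots,x_{n-1})\mapsto(x_1,\dots,x_{n-1},f_1(x_0,\dots,x_{n-1}))$; its characteristic function is $f(x_0,\dots,x_n)=x_n\oplus f_1(x_0,\dots,x_{n-1})$ and the FSR is identified with $f$. For an $n$-stage FSR $f$ and an $m$-stage FSR $g$ (with $n,m\ge 1$), the product FSR is the $(n+m)$-stage FSR $(f* g)(x_0,\dots,x_{n+m})=f\big(g(x_0,\dots,x_m),g(x_1,\dots,x_{m+1}),\dots,g(x_n,\dots,x_{n+m})\big)$. An FSR $h$ is decomposable if $h=f*g$ for some FSRs $f,g$, and indecomposable otherwise. A decision problem $P$ is polynomial-time Karp reducible to $Q$ if there is a polynomial-time computable map $T$ from instances of $P$ to instances of $Q$ such that $x$ is a yes-instance of $P$ iff $T(x)$ is a yes-instance of $Q$. A problem is NP-hard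 if an NP-complete problem is polynomial-time Karp reducible to it. *)

theory Defs
  imports Main
begin

text \<open>A circuit with m inputs is a pair (m, gs). Wires 0..m-1 are the inputs
  (the sources); wire m+j is the j-th gate of gs. A gate may only read wires with
  a smaller index (acyclicity). The output (the sink) is the last wire.
  The size is the number of vertices, m + length gs.\<close>

datatype gate = NotG nat | AndG nat nat | OrG nat nat

type_synonym circuit = "nat \<times> gate list"

fun gate_args :: "gate \<Rightarrow> nat set" where
  "gate_args (NotG a) = {a}"
| "gate_args (AndG a b) = {a, b}"
| "gate_args (OrG a b) = {a, b}"

definition circ_size :: "circuit \<Rightarrow> nat" where
  "circ_size C = fst C + length (snd C)"

text \<open>Well-formed: at least one vertex, gates only read earlier wires (DAG), and
  every vertex other than the output feeds some gate, so that the output is the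
  unique sink.\<close>
definition circ_wf :: "circuit \<Rightarrow> bool" where
  "circ_wf C \<longleftrightarrow> (case C of (m, gs) \<Rightarrow>
      1 \<le> m + length gs
    \<and> (\<forall>j < length gs. \<forall>a \<in> gate_args (gs ! j). a < m + j)
    \<and> (\<forall>i < m + length gs - 1. \<exists>j < length gs. i \<in> gate_args (gs ! j)))"

fun gate_val :: "bool list \<Rightarrow> gate \<Rightarrow> bool" where
  "gate_val vs (NotG a) = (\<not> vs ! a)"
| "gate_val vs (AndG a b) = (vs ! a \<and> vs ! b)"
| "gate_val vs (OrG a b) = (vs ! a \<or> vs ! b)"

definition circ_wires :: "gate list \<Rightarrow> bool list \<Rightarrow> bool list" where
  "circ_wires gs xs = foldl (\<lambda>vs g. vs @ [gate_val vs g]) xs gs"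

definition circ_eval :: "circuit \<Rightarrow> bool list \<Rightarrow> bool" where
  "circ_eval C xs = last (circ_wires (snd C) xs)"

definition circ_satisfiable :: "circuit \<Rightarrow> bool" where
  "circ_satisfiable C \<longleftrightarrow> (\<exists>xs. length xs = fst C \<and> circ_eval C xs)"

definition fsr_char :: "nat \<Rightarrow> (bool list \<Rightarrow> bool) \<Rightarrow> bool list \<Rightarrow> bool" where
  "fsr_char n f1 xs = (xs ! n \<noteq> f1 (take n xs))"

definition fsr_prod :: "nat \<Rightarrow> (bool list \<Rightarrow> bool) \<Rightarrow> nat \<Rightarrow> (bool list \<Rightarrow> bool)
    \<Rightarrow> bool list \<Rightarrow> bool" where
  "fsr_prod n f1 m g1 xs =
     fsr_char n f1 (map (\<lambda>i. fsr_char m g1 (take (m + 1) (drop i xs))) [0..<n + 1])"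

definition fsr_decomposable :: "nat \<Rightarrow> (bool list \<Rightarrow> bool) \<Rightarrow> bool" where
  "fsr_decomposable N h1 \<longleftrightarrow>
     (\<exists>n m f1 g1. 1 \<le> n \<and> 1 \<le> m \<and> n + m = N \<and>
        (\<forall>xs. length xs = N + 1 \<longrightarrow> fsr_char N h1 xs = fsr_prod n f1 m g1 xs))"

definition fsr_indecomposable :: "nat \<Rightarrow> (bool list \<Rightarrow> bool) \<Rightarrow> bool" where
  "fsr_indecomposable N h1 \<longleftrightarrow> \<not> fsr_decomposable N h1"

definition circ_fsr_indecomposable :: "circuit \<Rightarrow> bool" where
  "circ_fsr_indecomposable C \<longleftrightarrow> fsr_indecomposable (fst C) (circ_eval C)"

definition enc_nat :: "nat \<Rightarrow> bool list" where
  "enc_nat k = replicate k True @ [False]"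

fun enc_gate :: "gate \<Rightarrow> bool list" where
  "enc_gate (NotG a) = [False, False] @ enc_nat a"
| "enc_gate (AndG a b) = [False, True] @ enc_nat a @ enc_nat b"
| "enc_gate (OrG a b) = [True, False] @ enc_nat a @ enc_nat b"

definition enc_circ :: "circuit \<Rightarrow> bool list" where
  "enc_circ C = enc_nat (fst C) @ concat (map enc_gate (snd C))"

text \<open>A machine (Q, S, delta) has states 0..Q-1 (0 = start, 1 = halt) and tape
  symbols 0..S-1 (0 = blank, 1 = bit False, 2 = bit True). delta q s = (q', s', d)
  means: enter q', write s', move the head by d in {-1,0,1}.\<close>

type_synonym tm = "nat \<times> nat \<times> (nat \<Rightarrow> nat \<Rightarrow> nat \<times> nat \<times> int)"
type_synonym tm_config = "nat \<times> (int \<Rightarrow> nat) \<times> int"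

definition tm_wf :: "tm \<Rightarrow> bool" where
  "tm_wf M \<longleftrightarrow> (case M of (Q, S, \<delta>) \<Rightarrow> 2 \<le> Q \<and> 3 \<le> S \<and>
     (\<forall>q < Q. \<forall>s < S. case \<delta> q s of (q', s', d) \<Rightarrow>
        q' < Q \<and> s' < S \<and> d \<in> {-1, 0, 1}))"

definition tm_step :: "tm \<Rightarrow> tm_config \<Rightarrow> tm_config" where
  "tm_step M c = (case M of (Q, S, \<delta>) \<Rightarrow> case c of (q, t, p) \<Rightarrow>
     if q = 1 then c
     else (case \<delta> q (t p) of (q', s', d) \<Rightarrow> (q', t(p := s'), p + d)))"

definition bit_sym :: "bool \<Rightarrow> nat" where
  "bit_sym b = (if b then 2 else 1)"

definition tm_init :: "bool list \<Rightarrow> tm_config" where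
  "tm_init w = (0, (\<lambda>i. if 0 \<le> i \<and> i < int (length w) then bit_sym (w ! nat i) else 0), 0)"

definition tm_halts_with :: "tm \<Rightarrow> bool list \<Rightarrow> nat \<Rightarrow> bool list \<Rightarrow> bool" where
  "tm_halts_with M w k out \<longleftrightarrow>
     (case (tm_step M ^^ k) (tm_init w) of (q, t, p) \<Rightarrow>
        q = 1 \<and> (\<forall>i < length out. t (int i) = bit_sym (out ! i)) \<and> t (int (length out)) = 0)"

definition poly_karp_reducible ::
  "('a \<Rightarrow> bool) \<Rightarrow> ('a \<Rightarrow> bool) \<Rightarrow> ('a \<Rightarrow> bool list)
   \<Rightarrow> ('b \<Rightarrow> bool) \<Rightarrow> ('b \<Rightarrow> bool) \<Rightarrow> ('b \<Rightarrow> bool list) \<Rightarrow> bool" where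
  "poly_karp_reducible instP yesP encP instQ yesQ encQ \<longleftrightarrow>
     (\<exists>T M c d. tm_wf M \<and>
        (\<forall>x. instP x \<longrightarrow>
           instQ (T x) \<and>
           (\<exists>k \<le> c * (length (encP x) + 1) ^ d. tm_halts_with M (encP x) k (encQ (T x))) \<and>
           (yesP x \<longleftrightarrow> yesQ (T x))))"

end

theory Submission
  imports Defs
begin

text \<open>A circuit \<open>C\<close> with \<open>k\<close> inputs is mapped to the feedback logic
  \<open>h\<^sub>1(x\<^sub>0, \<dots>, x\<^bsub>N-1\<^esub>) = x\<^sub>0 \<and> \<not> E\<close>, where \<open>N = k + 3\<close> and
  \<open>E = x\<^sub>1 \<and> (x\<^sub>2 \<longleftrightarrow> x\<^bsub>N-1\<^esub>) \<and> C(x\<^sub>3, \<dots>, x\<^bsub>N-1\<^esub>)\<close>. If \<open>C\<close> is unsatisfiable then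
  \<open>h = x\<^sub>N \<oplus> x\<^sub>0\<close>, which is \<open>(x\<^sub>1 \<oplus> x\<^sub>0) * (x\<^sub>0 \<oplus> \<dots> \<oplus> x\<^bsub>N-1\<^esub>)\<close>.

  Conversely let \<open>h = f * g\<close> and \<open>y\<^sub>i = x\<^bsub>i+m\<^esub> \<oplus> g\<^sub>1(x\<^sub>i, \<dots>, x\<^bsub>i+m-1\<^esub>)\<close>. The variable \<open>x\<^sub>0\<close> enters
  \<open>h\<^sub>1 = g\<^sub>1(x\<^sub>n, \<dots>, x\<^bsub>N-1\<^esub>) \<oplus> f\<^sub>1(y\<^sub>0, \<dots>, y\<^bsub>n-1\<^esub>)\<close> through \<open>y\<^sub>0\<close> only, so the derivative of \<open>h\<^sub>1\<close>
  in \<open>x\<^sub>0\<close> factors: \<open>\<not> E = A(y\<^sub>1, \<dots>, y\<^bsub>n-1\<^esub>) \<and> B(x\<^sub>1, \<dots>, x\<^bsub>m-1\<^esub>)\<close>. Take a point with \<open>E = 1\<close>.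
  If \<open>B = 0\<close> there, then \<open>E = 1\<close> still holds after flipping \<open>x\<^bsub>N-1\<^esub>\<close>, contradicting \<open>x\<^sub>2 = x\<^bsub>N-1\<^esub>\<close>.
  If \<open>A = 0\<close> there, then some point with the same \<open>y\<^sub>1, \<dots>, y\<^bsub>n-1\<^esub>\<close> and \<open>x\<^sub>1 = 0\<close> has \<open>E = 1\<close>,
  a contradiction.

  Since the new inputs come first, every wire index of \<open>C\<close> grows by exactly 3. The encoding of the new
  circuit is therefore a concatenation of a constant number of finite-state transductions of the
  encoding of \<open>C\<close>, and a Turing machine can perform such sweeps in quadratic time.\<close>

section \<open>Indecomposability of a gated shift register\<close>

text \<open>Points are infinite sequences read through finite windows: shifting becomes a change of
  index, and flipping one coordinate is a function update.\<close>

definition window :: "nat \<Rightarrow> (nat \<Rightarrow> 'a) \<Rightarrow> nat \<Rightarrow> 'a list" where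
  "window m x i = map x [i..<i + m]"

lemma window_cong: "(\<And>j. i \<le> j \<Longrightarrow> j < i + m \<Longrightarrow> x j = z j) \<Longrightarrow> window m x i = window m z i"
  by (simp add: window_def)

definition filtered :: "nat \<Rightarrow> (bool list \<Rightarrow> bool) \<Rightarrow> (nat \<Rightarrow> bool) \<Rightarrow> nat \<Rightarrow> bool" where
  "filtered m g1 x i \<longleftrightarrow> x (i + m) \<noteq> g1 (window m x i)"

lemma fsr_char_window: "fsr_char m g1 (window (m + 1) x i) = filtered m g1 x i"
  by (simp add: fsr_char_def window_def filtered_def take_map nth_append)

lemma fsr_prod_window:
  "fsr_prod n f1 m g1 (window (n + m + 1) x 0) = (filtered m g1 x n \<noteq> f1 (window n (filtered m g1 x) 0))"
proof -
  have "take (m + 1) (drop i (window (n + m + 1) x 0)) = window (m + 1) x i" if "i < n + 1" for i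
    using that by (simp add: window_def take_map drop_map drop_upt take_upt del: upt_Suc)
  then have "map (\<lambda>i. fsr_char m g1 (take (m + 1) (drop i (window (n + m + 1) x 0)))) [0..<n + 1]
      = window (n + 1) (filtered m g1 x) 0"
    unfolding window_def[of "n + 1"] by (intro map_cong) (simp_all add: fsr_char_window del: upt_Suc One_nat_def add_Suc_right add_Suc)
  then have "fsr_prod n f1 m g1 (window (n + m + 1) x 0) = fsr_char n f1 (window (n + 1) (filtered m g1 x) 0)"
    by (simp only: fsr_prod_def)
  then show ?thesis
    by (simp only: fsr_char_window filtered_def) (simp add: filtered_def)
qed

text \<open>Both characteristic functions carry x_N as an xor summand. Cancelling it leaves an
  identity between feedback logics in x_0, ..., x_(N-1).\<close>

lemma fsr_decomposable_windowE:
  assumes "fsr_decomposable N h1"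
  obtains n m f1 g1 where "1 \<le> n" "1 \<le> m" "n + m = N"
    "\<And>x. h1 (window N x 0) = (g1 (window m x n) \<noteq> f1 (window n (filtered m g1 x) 0))"
proof -
  from assms obtain n m f1 g1 where nm: "1 \<le> n" "1 \<le> m" "n + m = N"
    and eq: "\<And>xs. length xs = N + 1 \<Longrightarrow> fsr_char N h1 xs = fsr_prod n f1 m g1 xs"
    unfolding fsr_decomposable_def by blast
  have "h1 (window N x 0) = (g1 (window m x n) \<noteq> f1 (window n (filtered m g1 x) 0))" for x
  proof -
    have "fsr_char N h1 (window (N + 1) x 0) = fsr_prod n f1 m g1 (window (N + 1) x 0)"
      by (rule eq) (simp add: window_def)
    then have "filtered N h1 x 0 = (filtered m g1 x n \<noteq> f1 (window n (filtered m g1 x) 0))"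
      using fsr_prod_window[of n f1 m g1 x] by (simp only: fsr_char_window nm)
    then show ?thesis
      using nm by (auto simp: filtered_def)
  qed
  with nm show thesis by (rule that)
qed

text \<open>The coordinate i + m enters the value at i as an xor summand, so the equations can be
  solved one after the other. The first one, at i = 1, fixes x_(m+1), which leaves x_0, ..., x_m
  free to be 0.\<close>

lemma filtered_preimage:
  assumes "1 \<le> m"
  shows "\<exists>x. (\<forall>j\<le>m. \<not> x j) \<and> (\<forall>i\<in>{1..<n}. filtered m g1 x i = y i)"
proof (induction n)
  case 0
  show ?case by (rule exI[of _ "\<lambda>_. False"]) simp
next
  case (Suc n)
  then obtain x where x: "\<forall>j\<le>m. \<not> x j" "\<forall>i\<in>{1..<n}. filtered m g1 x i = y i" by blast
  show ?case
  proof (cases "n = 0")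
    case True
    with x show ?thesis by auto
  next
    case False
    define z where "z = x(n + m := (y n \<noteq> g1 (window m x n)))"
    have "window m z i = window m x i" if "i \<le> n" for i
      by (rule window_cong) (use that in \<open>auto simp: z_def\<close>)
    then have "filtered m g1 z i = y i" if "i \<in> {1..<Suc n}" for i
      using x(2) that by (cases "i = n") (auto simp: filtered_def z_def)
    moreover have "\<forall>j\<le>m. \<not> z j" using x(1) False by (auto simp: z_def)
    ultimately show ?thesis by blast
  qed
qed

theorem gated_fsr_indecomposable:
  assumes "4 \<le> N"
    and h1: "\<And>x. h1 (window N x 0) \<longleftrightarrow> x 0 \<and> \<not> (x 1 \<and> x 2 = x (N - 1) \<and> P (window (N - 3) x 3))"
    and sat: "P u" "length u = N - 3"
  shows "fsr_indecomposable N h1"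
proof -
  have False if dec: "fsr_decomposable N h1"
  proof -
    obtain n m f1 g1 where nm: "1 \<le> n" "1 \<le> m" "n + m = N"
      and eq: "\<And>x. h1 (window N x 0) = (g1 (window m x n) \<noteq> f1 (window n (filtered m g1 x) 0))"
      using fsr_decomposable_windowE[OF dec] by metis
    let ?y = "filtered m g1"
    define gate where "gate x \<longleftrightarrow> x 1 \<and> x 2 = x (N - 1) \<and> P (window (N - 3) x 3)" for x
    \<comment> \<open>A point with E = 1: \<open>u\<close> fills the inputs of the embedded circuit,
      and x_2 copies its last bit, which is x_(N-1). The value at 0 is immaterial, since x_0 is
      always overwritten below.\<close>
    define x where "x j = (if j = 1 then True else if j = 2 then last u else u ! (j - 3))" for j
    have y_shift: "?y (x(0 := b)) i = ?y x i" if "1 \<le> i" for x b i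
    proof -
      have "window m (x(0 := b)) i = window m x i"
        by (rule window_cong) (use that in auto)
      with that nm show ?thesis by (simp add: filtered_def)
    qed
    have windowSuc: "window n' z 0 = z 0 # window (n' - 1) z 1" if "1 \<le> n'" for n' and z :: "nat \<Rightarrow> bool"
      using that by (cases n') (simp_all add: window_def upt_rec del: upt_Suc)
    have y_window: "window n (?y (x(0 := b))) 0 = ?y (x(0 := b)) 0 # window (n - 1) (?y x) 1" for x b
    proof -
      have "window (n - 1) (?y (x(0 := b))) 1 = window (n - 1) (?y x) 1"
        by (rule window_cong) (rule y_shift)
      with windowSuc[OF nm(1), of "?y (x(0 := b))"] show ?thesis by simp
    qed
    have gx: "gate (x(0 := b)) = gate x" for x b
    proof -
      have "window (N - 3) (x(0 := b)) 3 = window (N - 3) x 3"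
        by (rule window_cong) auto
      with \<open>4 \<le> N\<close> show ?thesis by (simp add: gate_def)
    qed
    have hx: "h1 (window N (x(0 := b)) 0) \<longleftrightarrow> b \<and> \<not> gate x" for x b
    proof -
      have "h1 (window N (x(0 := b)) 0) \<longleftrightarrow> b \<and> \<not> gate (x(0 := b))"
        unfolding gate_def by (subst h1) simp
      then show ?thesis by (simp only: gx)
    qed
    \<comment> \<open>The bit b put in place of x_0 reaches the right side only through the first
      argument of \<open>f1\<close>; comparing both values of b gives the derivative in x_0.\<close>
    have eqx: "(b \<and> \<not> gate x) = (g1 (window m x n) \<noteq> f1 (?y (x(0 := b)) 0 # window (n - 1) (?y x) 1))" for x b
    proof -
      have "window m (x(0 := b)) n = window m x n"
        by (rule window_cong) (use nm in auto)
      with eq[of "x(0 := b)"] hx[of x b] y_window[of x b] show ?thesis by simp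
    qed
    have y0: "?y (x(0 := b)) 0 = (x m \<noteq> g1 (b # window (m - 1) x 1))" for x b
    proof -
      have "window (m - 1) (x(0 := b)) 1 = window (m - 1) x 1"
        by (rule window_cong) auto
      then show ?thesis
        using nm windowSuc[of m "x(0 := b)"] by (simp add: filtered_def)
    qed
    have "window (N - 3) x 3 = u"
      by (rule nth_equalityI) (use sat in \<open>auto simp: window_def x_def\<close>)
    moreover have "x 2 = x (N - 1)"
    proof -
      have "u \<noteq> []" using sat \<open>4 \<le> N\<close> by auto
      then have "last u = u ! (N - 4)" using sat by (simp add: last_conv_nth)
      moreover have "N - 1 \<noteq> 1" "N - 1 \<noteq> 2" "N - 1 - 3 = N - 4" using \<open>4 \<le> N\<close> by auto
      ultimately show ?thesis by (simp add: x_def)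
    qed
    ultimately have gate_x: "gate x" using sat by (simp add: gate_def x_def)
    show False
    proof (cases "g1 (True # window (m - 1) x 1) = g1 (False # window (m - 1) x 1)")
      case True
      \<comment> \<open>Here B = 0. As N - 1 >= m, the flip leaves x_1, ..., x_(m-1) and hence B
        unchanged, so the derivative still vanishes at \<open>z\<close>.\<close>
      define z where "z = x(N - 1 := \<not> x (N - 1))"
      have "window (m - 1) z 1 = window (m - 1) x 1"
        by (rule window_cong) (use nm in \<open>auto simp: z_def\<close>)
      then have "?y (z(0 := True)) 0 = ?y (z(0 := False)) 0"
        using True by (simp add: y0)
      then have "gate z" using eqx[of True z] eqx[of False z] by simp
      moreover have "N - 1 \<noteq> 2" using \<open>4 \<le> N\<close> by simp
      ultimately show False
        using gate_x by (auto simp: gate_def z_def)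
    next
      case False
      then have "?y (x(0 := True)) 0 \<noteq> ?y (x(0 := False)) 0" by (auto simp: y0)
      \<comment> \<open>Here y_0 takes both Boolean values as x_0 varies, while E = 1 makes the left
        side of \<open>eqx\<close> constant; so A = 0.\<close>
      then have indep: "f1 (b # window (n - 1) (?y x) 1) = f1 (c # window (n - 1) (?y x) 1)" for b c
        using eqx[of True x] eqx[of False x] gate_x by (cases b; cases c) auto
      obtain z where z: "\<forall>j\<le>m. \<not> z j" "\<forall>i\<in>{1..<n}. ?y z i = ?y x i"
        using filtered_preimage[OF nm(2), of n g1 "?y x"] by blast
      have "window (n - 1) (?y z) 1 = window (n - 1) (?y x) 1"
        by (rule window_cong) (use z(2) in auto)
      then have "gate z" using eqx[of True z] eqx[of False z] indep by auto
      then show False using z(1) nm by (simp add: gate_def)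
    qed
  qed
  then show ?thesis by (auto simp: fsr_indecomposable_def)
qed

text \<open>The outer FSR adds the parities of two consecutive windows of length N. Their common
  bits cancel, leaving x_0 xor x_N.\<close>

lemma pure_cycling_fsr_decomposable:
  assumes "2 \<le> N" and h1: "\<And>xs. length xs = N \<Longrightarrow> h1 xs = hd xs"
  shows "fsr_decomposable N h1"
proof -
  define par where "par xs = foldr (\<noteq>) xs False" for xs :: "bool list"
  have par_snoc: "par (xs @ [b]) = (par xs \<noteq> b)" for xs b
    by (induction xs) (auto simp: par_def)
  have "fsr_char N h1 xs = fsr_prod 1 hd (N - 1) par xs" if len: "length xs = N + 1" for xs
  proof -
    from len \<open>2 \<le> N\<close> obtain a ys where "xs = a # ys" "length ys = N" by (cases xs) auto
    moreover from this \<open>2 \<le> N\<close> obtain ys' c where "ys = ys' @ [c]" "length ys' = N - 1"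
      by (cases ys rule: rev_cases) auto
    moreover from this \<open>2 \<le> N\<close> obtain zs b where "ys' = zs @ [b]" "length zs = N - 2"
      by (cases ys' rule: rev_cases) auto
    ultimately have xs: "xs = a # zs @ [b, c]" and zs: "length zs = N - 2" by auto
    have "fsr_char N h1 xs = (c \<noteq> a)"
      using zs h1[of "a # zs @ [b]"] \<open>2 \<le> N\<close> 
      by (cases N) (auto simp: fsr_char_def xs nth_Cons' nth_append)
    moreover have "N - 1 = Suc (length zs)" using zs \<open>2 \<le> N\<close> by simp
    then have "fsr_prod 1 hd (N - 1) par xs = (c \<noteq> a)"
      by (simp add: fsr_prod_def fsr_char_def xs nth_append par_snoc) (auto simp: par_def)
    ultimately show ?thesis by simp
  qed
  then show ?thesis
    using \<open>2 \<le> N\<close> unfolding fsr_decomposable_def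
    by (intro exI[of _ 1] exI[of _ "N - 1"] exI[of _ hd] exI[of _ par]) auto
qed

section \<open>The circuit reduction\<close>

fun shift_gate :: "nat \<Rightarrow> gate \<Rightarrow> gate" where
  "shift_gate d (NotG a) = NotG (a + d)"
| "shift_gate d (AndG a b) = AndG (a + d) (b + d)"
| "shift_gate d (OrG a b) = OrG (a + d) (b + d)"

lemma gate_args_shift: "gate_args (shift_gate d g) = (\<lambda>a. a + d) ` gate_args g"
  by (cases g) auto

lemma gate_val_shift: "gate_val (ps @ vs) (shift_gate (length ps) g) = gate_val vs g"
  by (cases g) (auto simp: nth_append)

lemma circ_wires_Nil [simp]: "circ_wires [] xs = xs"
  by (simp add: circ_wires_def)

lemma circ_wires_Cons [simp]: "circ_wires (g # gs) xs = circ_wires gs (xs @ [gate_val xs g])"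
  by (simp add: circ_wires_def)

lemma circ_wires_append: "circ_wires (gs @ gs') xs = circ_wires gs' (circ_wires gs xs)"
  by (simp add: circ_wires_def)

lemma length_circ_wires [simp]: "length (circ_wires gs xs) = length xs + length gs"
  by (induction gs arbitrary: xs) auto

lemma nth_circ_wires: "i < length xs \<Longrightarrow> circ_wires gs xs ! i = xs ! i"
  by (induction gs arbitrary: xs) (auto simp: nth_append)

lemma circ_wires_shift:
  "circ_wires (map (shift_gate (length ps)) gs) (ps @ xs) = ps @ circ_wires gs xs"
proof (induction gs arbitrary: xs)
  case (Cons g gs)
  show ?case using Cons[of "xs @ [gate_val xs g]"] by (simp add: gate_val_shift)
qed simp

text \<open>\<open>w\<close> is the output wire of the embedded circuit, so the j-th gate of the list is wire \<open>w + 1 + j\<close>.\<close>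
definition gadget :: "nat \<Rightarrow> nat \<Rightarrow> gate list" where
  "gadget l w = [AndG 2 l, OrG 2 l, NotG (w + 2), OrG (w + 1) (w + 3), AndG (w + 4) w,
     AndG 1 (w + 5), NotG (w + 6), AndG 0 (w + 7)]"

text \<open>The last input moves from wire \<open>fst C - 1\<close> to \<open>fst C + 2\<close>, the
  old output from \<open>circ_size C - 1\<close> to \<open>circ_size C + 2\<close>.\<close>

definition reduce_circ :: "circuit \<Rightarrow> circuit" where
  "reduce_circ C = (fst C + 3,
     map (shift_gate 3) (snd C) @ gadget (fst C + 2) (circ_size C + 2))"

text \<open>Wire w+4 is the equivalence of wires 2 and l, built as a conjunction or a negated
  disjunction; w+6 is E, w+7 its negation, and w+8 adds the factor x_0.\<close>

lemma gadget_eval: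
  assumes "length vs = Suc w" "3 \<le> w" "l \<le> w"
  shows "last (circ_wires (gadget l w) vs) \<longleftrightarrow> vs ! 0 \<and> \<not> (vs ! 1 \<and> vs ! 2 = vs ! l \<and> last vs)"
proof -
  have "last vs = vs ! w" using assms by (cases vs rule: rev_cases) auto
  with assms show ?thesis by (auto simp: gadget_def nth_append)
qed

text \<open>Without inputs the first gate would have to read a wire below 0. One input of C gives N
  >= 4, so x_2 and x_(N-1) are different variables.\<close>

lemma circ_wf_inputs: "circ_wf C \<Longrightarrow> 1 \<le> fst C"
proof (rule ccontr)
  assume wf: "circ_wf C" and "\<not> 1 \<le> fst C"
  then obtain gs where C: "C = (0, gs)" "gs \<noteq> []" by (cases C) (auto simp: circ_wf_def not_less_eq_eq Suc_le_eq)
  with wf have "\<forall>a \<in> gate_args (gs ! 0). a < 0" by (auto simp: circ_wf_def)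
  then show False by (cases "gs ! 0") auto
qed

lemma circ_eval_reduce:
  assumes "1 \<le> fst C" "length xs = fst C + 3"
  shows "circ_eval (reduce_circ C) xs \<longleftrightarrow>
    xs ! 0 \<and> \<not> (xs ! 1 \<and> xs ! 2 = xs ! (fst C + 2) \<and> circ_eval C (drop 3 xs))"
proof -
  define vs where "vs = take 3 xs @ circ_wires (snd C) (drop 3 xs)"
  have "circ_wires (map (shift_gate 3) (snd C)) xs = vs"
    using circ_wires_shift[of "take 3 xs" "snd C" "drop 3 xs"] assms by (simp add: vs_def)
  then have "circ_eval (reduce_circ C) xs = last (circ_wires (gadget (fst C + 2) (circ_size C + 2)) vs)"
    by (simp add: circ_eval_def reduce_circ_def circ_wires_append)
  also have "\<dots> \<longleftrightarrow> vs ! 0 \<and> \<not> (vs ! 1 \<and> vs ! 2 = vs ! (fst C + 2) \<and> last vs)"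
    by (rule gadget_eval) (use assms in \<open>auto simp: vs_def circ_size_def\<close>)
  also have "vs ! 0 = xs ! 0"
    using assms by (simp add: vs_def nth_append)
  also have "vs ! 1 = xs ! 1"
    using assms by (simp add: vs_def nth_append)
  also have "vs ! 2 = xs ! 2"
    using assms by (simp add: vs_def nth_append)
  also have "vs ! (fst C + 2) = xs ! (fst C + 2)"
    using assms by (auto simp: vs_def nth_append nth_circ_wires)
  also have "last vs = circ_eval C (drop 3 xs)"
  proof -
    have "length (circ_wires (snd C) (drop 3 xs)) \<noteq> 0" using assms by simp
    then have "circ_wires (snd C) (drop 3 xs) \<noteq> []" by (metis list.size(3))
    then show ?thesis by (simp add: vs_def circ_eval_def)
  qed
  finally show ?thesis .
qed

lemma circ_wf_reduce:
  assumes wf: "circ_wf C"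
  shows "circ_wf (reduce_circ C)"
proof -
  obtain k gs where C: "C = (k, gs)" by (cases C)
  let ?L = "length gs"
  define G where "G = gadget (k + 2) (k + ?L + 2)"
  let ?gs = "map (shift_gate 3) gs @ G"
  have k: "1 \<le> k" using circ_wf_inputs[OF wf] C by simp
  have args: "\<And>j a. j < ?L \<Longrightarrow> a \<in> gate_args (gs ! j) \<Longrightarrow> a < k + j"
    and used: "\<And>i. i < k + ?L - 1 \<Longrightarrow> \<exists>j<?L. i \<in> gate_args (gs ! j)"
    using wf by (auto simp: C circ_wf_def)
  have G8: "length G = 8" by (simp add: G_def gadget_def)
  have gargs: "\<forall>a \<in> gate_args (G ! j). a < k + 3 + ?L + j" if "j < 8" for j
  proof -
    have "j \<in> {0, 1, 2, 3, 4, 5, 6, 7}" using that by auto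
    then show ?thesis by (auto simp: G_def gadget_def)
  qed
  have 1: "a < k + 3 + j" if "j < length ?gs" "a \<in> gate_args (?gs ! j)" for j a
  proof (cases "j < ?L")
    case True
    with that args show ?thesis by (auto simp: nth_append gate_args_shift)
  next
    case False
    with that have "j - ?L < 8" "a \<in> gate_args (G ! (j - ?L))" by (auto simp: nth_append G8)
    with gargs have "a < k + 3 + ?L + (j - ?L)" by blast
    with False show ?thesis by simp
  qed
  have 2: "\<exists>j<length ?gs. i \<in> gate_args (?gs ! j)" if i: "i < k + 3 + length ?gs - 1" for i
  proof (cases "3 \<le> i \<and> i - 3 < k + ?L - 1")
    case True
    then obtain j where "j < ?L" "i - 3 \<in> gate_args (gs ! j)" using used by blast
    with True show ?thesis
      by (intro exI[of _ j]) (force simp: nth_append gate_args_shift)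
  next
    case False
    define w where "w = k + ?L + 2"
    have "i \<le> w + 7" "i < 3 \<or> w \<le> i"
      using False i k G8 by (auto simp: w_def)
    then have "i \<in> {0, 1, 2, w, w + 1, w + 2, w + 3, w + 4, w + 5, w + 6, w + 7}" by auto
    \<comment> \<open>Old wires below the old output keep their readers. The listed gadget gates
      read all others: the three new inputs, the old output \<open>w\<close> and the gadget wires
      before the sink.\<close>
    then have "i \<in> (\<Union>j\<in>{0, 2, 3, 4, 5, 6, 7::nat}. gate_args (G ! j))"
      by (auto simp: G_def gadget_def w_def)
    then obtain j where "j \<in> {0, 2, 3, 4, 5, 6, 7::nat}" "i \<in> gate_args (G ! j)" by blast
    moreover from this have "j < 8" by auto
    ultimately show ?thesis
      by (intro exI[of _ "?L + j"]) (simp add: nth_append G8)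
  qed
  have "reduce_circ C = (k + 3, ?gs)"
    by (simp add: reduce_circ_def C circ_size_def G_def)
  then show ?thesis
    using 1 2 by (auto simp: circ_wf_def)
qed

lemma satisfiable_iff_indecomposable_reduce:
  assumes wf: "circ_wf C"
  shows "circ_satisfiable C \<longleftrightarrow> circ_fsr_indecomposable (reduce_circ C)"
proof -
  let ?k = "fst C"
  have k: "1 \<le> ?k" by (rule circ_wf_inputs[OF wf])
  have fstR: "fst (reduce_circ C) = ?k + 3" by (simp add: reduce_circ_def)
  show ?thesis
  proof
    assume "circ_satisfiable C"
    then obtain u where u: "length u = ?k" "circ_eval C u" by (auto simp: circ_satisfiable_def)
    have "fsr_indecomposable (?k + 3) (circ_eval (reduce_circ C))"
    proof (rule gated_fsr_indecomposable[where P = "circ_eval C" and u = u])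
      fix x :: "nat \<Rightarrow> bool"
      have "drop 3 (window (?k + 3) x 0) = window ?k x 3"
        by (simp add: window_def drop_map add.commute)
      then show "circ_eval (reduce_circ C) (window (?k + 3) x 0) \<longleftrightarrow>
        x 0 \<and> \<not> (x 1 \<and> x 2 = x (?k + 3 - 1) \<and> circ_eval C (window (?k + 3 - 3) x 3))"
        using circ_eval_reduce[OF k, of "window (?k + 3) x 0"]
        by (simp add: window_def numeral_2_eq_2 del: upt_Suc)
    qed (use k u in auto)
    then show "circ_fsr_indecomposable (reduce_circ C)"
      by (simp add: circ_fsr_indecomposable_def fstR)
  next
    assume ind: "circ_fsr_indecomposable (reduce_circ C)"
    show "circ_satisfiable C"
    proof (rule ccontr)
      assume unsat: "\<not> circ_satisfiable C"
      have "fsr_decomposable (?k + 3) (circ_eval (reduce_circ C))"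
      proof (rule pure_cycling_fsr_decomposable)
        fix xs :: "bool list" assume len: "length xs = ?k + 3"
        then have "\<not> circ_eval C (drop 3 xs)" using unsat by (auto simp: circ_satisfiable_def)
        with len show "circ_eval (reduce_circ C) xs = hd xs"
          using circ_eval_reduce[OF k len] by (cases xs) auto
      qed simp
      with ind show False
        by (simp add: circ_fsr_indecomposable_def fstR fsr_indecomposable_def)
    qed
  qed
qed

section \<open>Turing machines over arbitrary finite state sets\<close>

text \<open>The machine model fixes the numbers of the start and halt states, the blank and the two
  bits, so the numbering must respect a prescribed initial list.\<close>

lemma finite_indexing:
  assumes "finite A" "distinct xs" "set xs \<subseteq> A"
  obtains f where "bij_betw f A {..<card A}" "\<And>i. i < length xs \<Longrightarrow> f (xs ! i) = i"
proof -
  obtain ys where ys: "set ys = A - set xs" "distinct ys"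
    using finite_distinct_list[of "A - set xs"] assms by auto
  let ?zs = "xs @ ys"
  have zs: "distinct ?zs" "set ?zs = A" using assms ys by auto
  then have card: "card A = length ?zs" by (metis distinct_card)
  have bij: "bij_betw ((!) ?zs) {..<length ?zs} A"
    by (rule bij_betw_nth) (use zs in auto)
  let ?f = "the_inv_into {..<length ?zs} ((!) ?zs)"
  show thesis
  proof
    show "bij_betw ?f A {..<card A}"
      unfolding card by (rule bij_betw_the_inv_into[OF bij])
    show "?f (xs ! i) = i" if "i < length xs" for i
      using the_inv_into_f_f[OF bij_betw_imp_inj_on[OF bij], of i] that by (simp add: nth_append)
  qed
qed

definition mstep :: "('s \<Rightarrow> 'a \<Rightarrow> 's \<times> 'a \<times> int) \<Rightarrow> 's \<Rightarrow> 's \<times> (int \<Rightarrow> 'a) \<times> int \<Rightarrow> 's \<times> (int \<Rightarrow> 'a) \<times> int" where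
  "mstep \<delta> h c = (case c of (s, t, p) \<Rightarrow>
     if s = h then c else (case \<delta> s (t p) of (s', a, d) \<Rightarrow> (s', t(p := a), p + d)))"

definition minit :: "'s \<Rightarrow> 'a \<Rightarrow> (bool \<Rightarrow> 'a) \<Rightarrow> bool list \<Rightarrow> 's \<times> (int \<Rightarrow> 'a) \<times> int" where
  "minit s0 bl sy w = (s0, (\<lambda>i. if 0 \<le> i \<and> i < int (length w) then sy (w ! nat i) else bl), 0)"

text \<open>Lets machines have structured states and symbols. Numbering them commutes with every
  step, because the run stays in A, where \<open>f\<close> is injective.\<close>

lemma tm_of_machine:
  fixes \<delta> :: "'s \<Rightarrow> 'a::finite \<Rightarrow> 's \<times> 'a \<times> int"
  assumes A: "finite A" "s0 \<in> A" "h \<in> A" "s0 \<noteq> h"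
    and sy: "distinct [bl, sy False, sy True]"
    and closed: "\<And>s a. s \<in> A \<Longrightarrow> \<delta> s a \<in> A \<times> UNIV \<times> {-1, 0, 1}"
  obtains M where "tm_wf M"
    "\<And>w k t p out. (mstep \<delta> h ^^ k) (minit s0 bl sy w) = (h, t, p) \<Longrightarrow>
       \<forall>i < length out. t (int i) = sy (out ! i) \<Longrightarrow> t (int (length out)) = bl \<Longrightarrow>
       tm_halts_with M w k out"
proof -
  obtain f where f: "bij_betw f A {..<card A}" "\<And>i. i < length [s0, h] \<Longrightarrow> f ([s0, h] ! i) = i"
    by (rule finite_indexing[of A "[s0, h]"]) (use A in auto)
  obtain g :: "'a \<Rightarrow> nat" where g: "bij_betw g UNIV {..<card (UNIV :: 'a set)}"
    "\<And>i. i < length [bl, sy False, sy True] \<Longrightarrow> g ([bl, sy False, sy True] ! i) = i"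
    by (rule finite_indexing[of UNIV "[bl, sy False, sy True]"]) (use sy in auto)
  have f01: "f s0 = 0" "f h = 1" using f(2)[of 0] f(2)[of 1] by auto
  have g012: "g bl = 0" "g (sy b) = bit_sym b" for b
    using g(2)[of 0] g(2)[of 1] g(2)[of 2] by (auto simp: bit_sym_def)
  have f_inj: "f s = f s' \<longleftrightarrow> s = s'" if "s \<in> A" "s' \<in> A" for s s'
    using f(1) that by (auto simp: bij_betw_def inj_on_def)
  define f' where "f' = the_inv_into A f"
  define g' where "g' = the_inv_into UNIV g"
  have f': "f' (f s) = s" if "s \<in> A" for s
    unfolding f'_def using that f(1) by (simp add: the_inv_into_f_f bij_betw_imp_inj_on)
  have g': "g' (g a) = a" for a
    unfolding g'_def using g(1) by (simp add: the_inv_into_f_f bij_betw_imp_inj_on)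
  have f_less: "f s < card A" if "s \<in> A" for s
    using f(1) that by (auto simp: bij_betw_def)
  have g_less: "g a < card (UNIV :: 'a set)" for a
    using g(1) by (auto simp: bij_betw_def)
  have f'_in: "f' q \<in> A" if "q < card A" for q
    using f(1) that unfolding f'_def by (metis bij_betw_def lessThan_iff order_refl the_inv_into_into)
  define M :: tm where "M = (card A, card (UNIV :: 'a set),
    (\<lambda>q a. case \<delta> (f' q) (g' a) of (s, b, d) \<Rightarrow> (f s, g b, d)))"
  have "tm_wf M"
  proof -
    have Q: "2 \<le> card A" using card_mono[of A "{s0, h}"] A by auto
    have S: "3 \<le> card (UNIV :: 'a set)"
      using card_mono[of "UNIV :: 'a set" "{bl, sy False, sy True}"] sy by auto
    have \<delta>: "case case \<delta> (f' q) (g' a) of (s, b, d) \<Rightarrow> (f s, g b, d) of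
        (q', a', d) \<Rightarrow> q' < card A \<and> a' < card (UNIV :: 'a set) \<and> d \<in> {-1, 0, 1}"
      if "q < card A" for q a
      using closed[OF f'_in[OF that], of "g' a"] f_less g_less by (auto split: prod.split)
    show ?thesis
      unfolding tm_wf_def M_def prod.case by (intro conjI allI impI Q S \<delta>)
  qed
  moreover have "tm_halts_with M w k out"
    if run: "(mstep \<delta> h ^^ k) (minit s0 bl sy w) = (h, t, p)"
      and out: "\<forall>i < length out. t (int i) = sy (out ! i)" "t (int (length out)) = bl" for w k t p out
  proof -
    define code where "code c = (case c of (s, t, p) \<Rightarrow> (f s, g \<circ> t, p))" for c :: "'s \<times> (int \<Rightarrow> 'a) \<times> int"
    have step: "tm_step M (code c) = code (mstep \<delta> h c) \<and> fst (mstep \<delta> h c) \<in> A" if "fst c \<in> A" for c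
    proof -
      obtain s t p where c: "c = (s, t, p)" by (cases c)
      obtain s' a d where d: "\<delta> s (t p) = (s', a, d)" by (cases "\<delta> s (t p)")
      have s: "s \<in> A" "s' \<in> A" using that c closed[of s "t p"] d by auto
      then show ?thesis
        using f_inj[OF s(1) A(3)] f01
        by (auto simp: c d tm_step_def M_def code_def mstep_def f' g' fun_eq_iff)
    qed
    have "(tm_step M ^^ k) (code c) = code ((mstep \<delta> h ^^ k) c) \<and> fst ((mstep \<delta> h ^^ k) c) \<in> A"
      if "fst c \<in> A" for c k
      using that by (induction k) (auto simp: step)
    from this[of "minit s0 bl sy w" k] have "(tm_step M ^^ k) (code (minit s0 bl sy w)) = code (h, t, p)"
      using A run by (simp add: minit_def)
    moreover have "code (minit s0 bl sy w) = tm_init w"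
      by (auto simp: code_def minit_def tm_init_def f01 g012 fun_eq_iff)
    ultimately show ?thesis
      using out by (simp add: tm_halts_with_def code_def f01 g012)
  qed
  ultimately show thesis by (rule that)
qed

definition runs_in :: "('c \<Rightarrow> 'c) \<Rightarrow> nat \<Rightarrow> 'c \<Rightarrow> 'c \<Rightarrow> bool" where
  "runs_in step b c c' \<longleftrightarrow> (\<exists>k\<le>b. (step ^^ k) c = c')"

lemma runs_in_refl: "runs_in step b c c"
  by (auto simp: runs_in_def intro: exI[of _ 0])

lemma runs_in_step: "step c = c' \<Longrightarrow> runs_in step b c' c'' \<Longrightarrow> runs_in step (Suc b) c c''"
  unfolding runs_in_def by (metis Suc_le_mono comp_apply funpow_Suc_right)

lemma runs_in_trans: "runs_in step b c c' \<Longrightarrow> runs_in step b' c' c'' \<Longrightarrow> runs_in step (b + b') c c''"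
  unfolding runs_in_def by (metis add.commute add_mono comp_apply funpow_add)

lemma runs_in_mono: "runs_in step b c c' \<Longrightarrow> b \<le> b' \<Longrightarrow> runs_in step b' c c'"
  by (auto simp: runs_in_def intro: order_trans)

section \<open>Sweeping transducers on Turing machines\<close>

fun transduce :: "('q \<Rightarrow> bool \<Rightarrow> 'q) \<Rightarrow> ('q \<Rightarrow> bool \<Rightarrow> 'b list) \<Rightarrow> 'q \<Rightarrow> bool list \<Rightarrow> 'b list" where
  "transduce nx em q [] = []"
| "transduce nx em q (b # bs) = em q b @ transduce nx em (nx q b) bs"

lemma transduce_append:
  "transduce nx em q (xs @ ys) = transduce nx em q xs @ transduce nx em (foldl nx q xs) ys"
  by (induction xs arbitrary: q) auto

text \<open>One input bit is treated per round trip: \<open>Find\<close> seeks the first unconsumed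
  bit, \<open>BackPut\<close> carries the emitted block to the left end, \<open>Put\<close> appends
  it to the result track, \<open>BackFind\<close> returns. The numbers count sweeps; the flag of
  \<open>BackPut\<close> asks to clear the consumed marks.\<close>

datatype 'q sweep_state = Find nat 'q | BackPut bool "bool list" nat 'q | Put "bool list" nat 'q
  | BackFind nat 'q | Halt

text \<open>A cell consists of an input bit, a flag telling whether that bit has been consumed in the
  current sweep, and an result bit.\<close>
type_synonym cell = "bool option \<times> bool \<times> bool option"

abbreviation blank :: cell where "blank \<equiv> (None, False, None)"

abbreviation bit_cell :: "bool \<Rightarrow> cell" where "bit_cell b \<equiv> (Some b, False, None)"

text \<open>All r sweeps share the automaton and differ in what they emit and append. The bound W
  keeps the states finite in number although they carry blocks.\<close>

locale sweeping_transducer =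
  fixes q0 :: "'q::finite" and nx :: "'q \<Rightarrow> bool \<Rightarrow> 'q"
    and em :: "nat \<Rightarrow> 'q \<Rightarrow> bool \<Rightarrow> bool list" and fin :: "nat \<Rightarrow> bool list"
    and r :: nat and W :: nat
  assumes em_le: "\<And>p q b. p < r \<Longrightarrow> length (em p q b) \<le> W"
    and fin_le: "\<And>p. p < r \<Longrightarrow> length (fin p) \<le> W"
begin

definition sweep :: "nat \<Rightarrow> bool list \<Rightarrow> bool list" where
  "sweep p w = transduce nx (em p) q0 w @ fin p"

text \<open>The blank cell at -1 marks the left end. Once p = r, \<open>Find\<close> turns result
  bits into plain bit cells from left to right and halts on a blank behind them.\<close>

fun \<delta> :: "'q sweep_state \<Rightarrow> cell \<Rightarrow> 'q sweep_state \<times> cell \<times> int" where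
  "\<delta> (Find p q) (i, f, u) =
     (if p < r then
        if f then (Find p q, (i, f, u), 1)
        else case i of
            Some b \<Rightarrow> (BackPut False (em p q b) p (nx q b), (i, True, u), -1)
          | None \<Rightarrow> (BackPut True (fin p) (Suc p) q0, (i, f, u), -1)
      else case u of
            Some b \<Rightarrow> (Find p q, bit_cell b, 1)
          | None \<Rightarrow> (Halt, blank, 0))"
| "\<delta> (BackPut c ws p q) (i, f, u) =
     (if (i, f, u) = blank then (Put ws p q, blank, 1) else (BackPut c ws p q, (i, f \<and> \<not> c, u), -1))"
| "\<delta> (Put [] p q) a = (BackFind p q, a, -1)"
| "\<delta> (Put (b # bs) p q) (i, f, u) =
     (if u = None then (Put bs p q, (i, f, Some b), 1) else (Put (b # bs) p q, (i, f, u), 1))"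
| "\<delta> (BackFind p q) a = (if a = blank then (Find p q, a, 1) else (BackFind p q, a, -1))"
| "\<delta> Halt a = (Halt, a, 0)"

definition states :: "'q sweep_state set" where
  "states = (\<lambda>(p, q). Find p q) ` ({..r} \<times> UNIV)
    \<union> (\<lambda>(c, ws, p, q). BackPut c ws p q) ` (UNIV \<times> {ws. length ws \<le> W} \<times> {..r} \<times> UNIV)
    \<union> (\<lambda>(ws, p, q). Put ws p q) ` ({ws. length ws \<le> W} \<times> {..r} \<times> UNIV)
    \<union> (\<lambda>(p, q). BackFind p q) ` ({..r} \<times> UNIV) \<union> {Halt}"

lemma states_simps [simp]:
  "Find p q \<in> states \<longleftrightarrow> p \<le> r"
  "BackPut c ws p q \<in> states \<longleftrightarrow> length ws \<le> W \<and> p \<le> r"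
  "Put ws p q \<in> states \<longleftrightarrow> length ws \<le> W \<and> p \<le> r"
  "BackFind p q \<in> states \<longleftrightarrow> p \<le> r"
  "Halt \<in> states"
  by (auto simp: states_def image_iff)

lemma finite_states: "finite states"
proof -
  have "finite {ws :: bool list. length ws \<le> W}"
    using finite_lists_length_le[of "UNIV :: bool set" W] by simp
  then show ?thesis by (simp add: states_def)
qed

lemma \<delta>_closed: "s \<in> states \<Longrightarrow> \<delta> s a \<in> states \<times> UNIV \<times> {-1, 0, 1}"
  by (cases "(s, a)" rule: \<delta>.cases) (auto simp: em_le fin_le split: option.splits)

abbreviation step :: "'q sweep_state \<times> (int \<Rightarrow> cell) \<times> int \<Rightarrow> 'q sweep_state \<times> (int \<Rightarrow> cell) \<times> int" where
  "step \<equiv> mstep \<delta> Halt"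

definition tape :: "bool list \<Rightarrow> nat \<Rightarrow> bool list \<Rightarrow> int \<Rightarrow> cell" where
  "tape w fl out i = (if i < 0 then blank else
     (if nat i < length w then Some (w ! nat i) else None, nat i < fl,
      if nat i < length out then Some (out ! nat i) else None))"

lemma tape_negative: "tape w fl out (-1) = blank"
  by (simp add: tape_def)

lemma tape_nonblank: "i < max (length w) (length out) \<Longrightarrow> tape w fl out (int i) \<noteq> blank"
  by (auto simp: tape_def)

lemma step_trivial_write:
  "\<delta> s (t p) = (s', t p, d) \<Longrightarrow> s \<noteq> Halt \<Longrightarrow> step (s, t, p) = (s', t, p + d)"
  by (simp add: mstep_def)

section \<open>Running times of the single phases of a sweep\<close>

lemma find_run:
  assumes "p < r" "j \<le> fl"
  shows "runs_in step j (Find p q, tape w fl out, int (fl - j)) (Find p q, tape w fl out, int fl)"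
  using assms
proof (induction j)
  case 0
  show ?case by (simp add: runs_in_refl)
next
  case (Suc j)
  then have "\<delta> (Find p q) (tape w fl out (int (fl - Suc j)))
      = (Find p q, tape w fl out (int (fl - Suc j)), 1)"
    by (simp add: tape_def del: of_nat_diff)
  moreover have "int (fl - Suc j) + 1 = int (fl - j)" using Suc.prems by simp
  ultimately have "step (Find p q, tape w fl out, int (fl - Suc j)) = (Find p q, tape w fl out, int (fl - j))"
    by (simp add: step_trivial_write del: of_nat_diff)
  with Suc show ?case by (auto intro: runs_in_step)
qed

text \<open>Every cell below the longer of the two tracks is nonblank, so the first blank met on the
  way left is at -1.\<close>

lemma backfind_run:
  "j \<le> max (length w) (length out) \<Longrightarrow>
   runs_in step (Suc j) (BackFind p q, tape w fl out, int j - 1) (Find p q, tape w fl out, 0)"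
proof (induction j)
  case 0
  have "step (BackFind p q, tape w fl out, -1) = (Find p q, tape w fl out, 0)"
    by (subst step_trivial_write) (auto simp: tape_negative)
  then show ?case by (auto intro: runs_in_step runs_in_refl)
next
  case (Suc j)
  have "step (BackFind p q, tape w fl out, int j) = (BackFind p q, tape w fl out, int j - 1)"
    using tape_nonblank[of j w out fl] Suc.prems by (subst step_trivial_write) auto
  with Suc show ?case by (auto intro: runs_in_step)
qed

lemma backput_run:
  "j \<le> max (length w) (length out) \<Longrightarrow>
   runs_in step (Suc j) (BackPut False ws p q, tape w fl out, int j - 1) (Put ws p q, tape w fl out, 0)"
proof (induction j)
  case 0
  have "step (BackPut False ws p q, tape w fl out, -1) = (Put ws p q, tape w fl out, 0)"
    by (subst step_trivial_write) (auto simp: tape_negative)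
  then show ?case by (auto intro: runs_in_step runs_in_refl)
next
  case (Suc j)
  have "step (BackPut False ws p q, tape w fl out, int j) = (BackPut False ws p q, tape w fl out, int j - 1)"
    using tape_nonblank[of j w out fl] Suc.prems
    by (subst step_trivial_write) (cases "tape w fl out (int j)"; auto)+
  with Suc show ?case by (auto intro: runs_in_step)
qed

text \<open>Clearing from right to left keeps the marks a prefix, so each intermediate tape is again
  of the form \<open>tape w j out\<close>.\<close>

lemma clear_run:
  "j \<le> length w \<Longrightarrow>
   runs_in step (Suc j) (BackPut True ws p q, tape w j out, int j - 1) (Put ws p q, tape w 0 out, 0)"
proof (induction j)
  case 0
  have "step (BackPut True ws p q, tape w 0 out, -1) = (Put ws p q, tape w 0 out, 0)"
    by (subst step_trivial_write) (auto simp: tape_negative)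
  then show ?case by (auto intro: runs_in_step runs_in_refl)
next
  case (Suc j)
  have "step (BackPut True ws p q, tape w (Suc j) out, int j) = (BackPut True ws p q, tape w j out, int j - 1)"
    using Suc.prems by (auto simp: mstep_def tape_def fun_eq_iff)
  with Suc show ?case by (auto intro: runs_in_step)
qed

lemma put_skip_run:
  "j \<le> length out \<Longrightarrow>
   runs_in step j (Put (b # bs) p q, tape w fl out, int (length out - j))
     (Put (b # bs) p q, tape w fl out, int (length out))"
proof (induction j)
  case 0
  show ?case by (simp add: runs_in_refl)
next
  case (Suc j)
  then have "\<delta> (Put (b # bs) p q) (tape w fl out (int (length out - Suc j)))
      = (Put (b # bs) p q, tape w fl out (int (length out - Suc j)), 1)"
    by (simp add: tape_def del: of_nat_diff)
  moreover have "int (length out - Suc j) + 1 = int (length out - j)" using Suc.prems by simp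
  ultimately have "step (Put (b # bs) p q, tape w fl out, int (length out - Suc j))
      = (Put (b # bs) p q, tape w fl out, int (length out - j))"
    by (simp add: step_trivial_write del: of_nat_diff)
  with Suc show ?case by (auto intro: runs_in_step)
qed

lemma put_write_run:
  "runs_in step (Suc (length ws)) (Put ws p q, tape w fl out, int (length out))
     (BackFind p q, tape w fl (out @ ws), int (length (out @ ws)) - 1)"
proof (induction ws arbitrary: out)
  case Nil
  have "step (Put [] p q, tape w fl out, int (length out)) = (BackFind p q, tape w fl out, int (length out) - 1)"
    by (subst step_trivial_write) auto
  then show ?case by (auto intro: runs_in_step runs_in_refl)
next
  case (Cons b bs)
  have "step (Put (b # bs) p q, tape w fl out, int (length out))
      = (Put bs p q, tape w fl (out @ [b]), int (length (out @ [b])))"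
    by (auto simp: mstep_def tape_def fun_eq_iff nth_append)
  with Cons[of "out @ [b]"] show ?case by (auto intro: runs_in_step)
qed

lemma put_run:
  assumes "length w \<le> Z" "length (out @ ws) \<le> Z"
  shows "runs_in step (2 * Z + 3) (Put ws p q, tape w fl out, 0) (Find p q, tape w fl (out @ ws), 0)"
\<comment> \<open>With an empty block the machine turns back at once instead of walking to the end
  of the result.\<close>
proof (cases ws)
  case Nil
  have "step (Put [] p q, tape w fl out, 0) = (BackFind p q, tape w fl out, int 0 - 1)"
    by (subst step_trivial_write) auto
  then have "runs_in step (Suc (Suc 0)) (Put [] p q, tape w fl out, 0) (Find p q, tape w fl out, 0)"
    using backfind_run[of 0] by (auto intro: runs_in_step)
  with Nil show ?thesis by (auto intro: runs_in_mono)
next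
  case (Cons b bs)
  have "runs_in step (length out) (Put ws p q, tape w fl out, 0) (Put ws p q, tape w fl out, int (length out))"
    using put_skip_run[of "length out" out b bs p q w fl] Cons by simp
  from runs_in_trans[OF runs_in_trans[OF this put_write_run] backfind_run]
  have "runs_in step (length out + Suc (length ws) + Suc (length (out @ ws)))
      (Put ws p q, tape w fl out, 0) (Find p q, tape w fl (out @ ws), 0)"
    by simp
  then show ?thesis by (rule runs_in_mono) (use assms in auto)
qed

text \<open>The cost is fl to find the bit, fl + 2 to consume it and return, and 2 Z + 3 to append
  the block, where fl <= Z.\<close>

lemma consume_run:
  assumes "p < r" "fl < length w" "length w \<le> Z" "length (out @ em p q (w ! fl)) \<le> Z"
  shows "runs_in step (4 * Z + 5) (Find p q, tape w fl out, 0)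
     (Find p (nx q (w ! fl)), tape w (Suc fl) (out @ em p q (w ! fl)), 0)"
proof -
  let ?ws = "em p q (w ! fl)" and ?q = "nx q (w ! fl)"
  have 1: "runs_in step fl (Find p q, tape w fl out, 0) (Find p q, tape w fl out, int fl)"
    using find_run[of p fl fl q w out] assms by simp
  have "step (Find p q, tape w fl out, int fl) = (BackPut False ?ws p ?q, tape w (Suc fl) out, int fl - 1)"
    using assms by (auto simp: mstep_def tape_def fun_eq_iff)
  then have 2: "runs_in step (Suc (Suc fl)) (Find p q, tape w fl out, int fl) (Put ?ws p ?q, tape w (Suc fl) out, 0)"
    by (rule runs_in_step) (rule backput_run, use assms in simp)
  show ?thesis
    by (rule runs_in_mono[OF runs_in_trans[OF runs_in_trans[OF 1 2] put_run[of w Z out ?ws]]])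
      (use assms in auto)
qed

lemma finish_run:
  assumes "p < r" "length w \<le> Z" "length (out @ fin p) \<le> Z"
  shows "runs_in step (4 * Z + 5) (Find p q, tape w (length w) out, 0)
     (Find (Suc p) q0, tape w 0 (out @ fin p), 0)"
proof -
  let ?n = "length w"
  have 1: "runs_in step ?n (Find p q, tape w ?n out, 0) (Find p q, tape w ?n out, int ?n)"
    using find_run[of p ?n ?n q w out] assms by simp
  have "step (Find p q, tape w ?n out, int ?n) = (BackPut True (fin p) (Suc p) q0, tape w ?n out, int ?n - 1)"
    using assms by (subst step_trivial_write) (auto simp: tape_def)
  then have 2: "runs_in step (Suc (Suc ?n)) (Find p q, tape w ?n out, int ?n) (Put (fin p) (Suc p) q0, tape w 0 out, 0)"
    by (rule runs_in_step) (rule clear_run, simp)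
  show ?thesis
    by (rule runs_in_mono[OF runs_in_trans[OF runs_in_trans[OF 1 2] put_run[of w Z out "fin p"]]])
      (use assms in auto)
qed

lemma sweep_run:
  assumes "p < r" "fl \<le> length w" "length w \<le> Z"
    "length (out @ transduce nx (em p) q (drop fl w) @ fin p) \<le> Z"
  shows "runs_in step (Suc (length w - fl) * (4 * Z + 5)) (Find p q, tape w fl out, 0)
     (Find (Suc p) q0, tape w 0 (out @ transduce nx (em p) q (drop fl w) @ fin p), 0)"
  using assms(2,4)
proof (induction "length w - fl" arbitrary: fl q out)
  case 0
  then have "fl = length w" by simp
  with 0 finish_run[OF assms(1,3), of out q] show ?case by simp
next
  case (Suc k)
  then have fl: "fl < length w" by simp
  have drop: "drop fl w = w ! fl # drop (Suc fl) w" using fl by (simp add: Cons_nth_drop_Suc)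
  let ?ws = "em p q (w ! fl)" and ?q = "nx q (w ! fl)"
  have k: "length w - fl = Suc k" "length w - Suc fl = k" using Suc(2) fl by auto
  have "runs_in step (4 * Z + 5) (Find p q, tape w fl out, 0) (Find p ?q, tape w (Suc fl) (out @ ?ws), 0)"
    using consume_run[OF assms(1) fl assms(3), of out q] Suc.prems by (simp add: drop)
  moreover have "runs_in step (Suc k * (4 * Z + 5)) (Find p ?q, tape w (Suc fl) (out @ ?ws), 0)
     (Find (Suc p) q0, tape w 0 (out @ transduce nx (em p) q (drop fl w) @ fin p), 0)"
    using Suc(1)[of "Suc fl" "out @ ?ws" ?q] Suc.prems fl k by (simp add: drop)
  ultimately have "runs_in step (4 * Z + 5 + Suc k * (4 * Z + 5)) (Find p q, tape w fl out, 0)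
     (Find (Suc p) q0, tape w 0 (out @ transduce nx (em p) q (drop fl w) @ fin p), 0)"
    by (rule runs_in_trans)
  then show ?case by (rule runs_in_mono) (simp add: k)
qed

section \<open>Output of all sweeps, its conversion, and the quadratic time bound\<close>

definition result :: "nat \<Rightarrow> bool list \<Rightarrow> bool list" where
  "result p w = concat (map (\<lambda>p. sweep p w) [0..<p])"

lemma result_Suc: "result (Suc p) w = result p w @ sweep p w"
  by (simp add: result_def)

lemma length_transduce: "p < r \<Longrightarrow> length (transduce nx (em p) q w) \<le> W * length w"
proof (induction w arbitrary: q)
  case (Cons b w)
  from Cons(1)[OF Cons(2), of "nx q b"] em_le[OF Cons(2), of q b] show ?case by simp
qed simp

lemma length_result: "p \<le> r \<Longrightarrow> length (result p w) \<le> p * (W * (length w + 1))"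
proof (induction p)
  case (Suc p)
  then have "length (sweep p w) \<le> W * (length w + 1)"
    using length_transduce[of p q0 w] fin_le[of p] by (simp add: sweep_def)
  with Suc show ?case by (simp add: result_Suc)
qed (simp add: result_def)

lemma sweeps_run:
  assumes "p \<le> r" "length w \<le> Z" "length (result p w) \<le> Z"
  shows "runs_in step (p * (Suc (length w) * (4 * Z + 5))) (Find 0 q0, tape w 0 [], 0)
     (Find p q0, tape w 0 (result p w), 0)"
  using assms
proof (induction p)
  case 0
  show ?case by (simp add: result_def runs_in_refl)
next
  case (Suc p)
  have "runs_in step (p * (Suc (length w) * (4 * Z + 5))) (Find 0 q0, tape w 0 [], 0)
     (Find p q0, tape w 0 (result p w), 0)"
    by (rule Suc.IH) (use Suc.prems in \<open>auto simp: result_Suc\<close>)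
  moreover have "runs_in step (Suc (length w) * (4 * Z + 5)) (Find p q0, tape w 0 (result p w), 0)
     (Find (Suc p) q0, tape w 0 (result (Suc p) w), 0)"
    using sweep_run[of p 0 w Z "result p w" q0] Suc.prems by (simp add: result_Suc sweep_def)
  ultimately have "runs_in step (p * (Suc (length w) * (4 * Z + 5)) + Suc (length w) * (4 * Z + 5))
     (Find 0 q0, tape w 0 [], 0) (Find (Suc p) q0, tape w 0 (result (Suc p) w), 0)"
    by (rule runs_in_trans)
  then show ?case by (rule runs_in_mono) simp
qed

text \<open>Midway the tape is mixed, with plain bits on the left and two tracks on the right, so
  the induction takes any \<open>t\<close> with these two parts; j counts the bits left.\<close>

lemma convert_run:
  assumes "j \<le> length out" "\<And>i. i < length out - j \<Longrightarrow> t (int i) = bit_cell (out ! i)"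
    "\<And>i. length out - j \<le> i \<Longrightarrow> t (int i) = tape w 0 out (int i)"
  shows "\<exists>t'. runs_in step (Suc j) (Find r q, t, int (length out - j)) (Halt, t', int (length out)) \<and>
     (\<forall>i < length out. t' (int i) = bit_cell (out ! i)) \<and> t' (int (length out)) = blank"
  using assms
proof (induction j arbitrary: t)
  case 0
  let ?t = "t(int (length out) := blank)"
  have "step (Find r q, t, int (length out)) = (Halt, ?t, int (length out))"
    using 0(3)[of "length out"] by (simp add: mstep_def tape_def)
  then have "runs_in step (Suc 0) (Find r q, t, int (length out)) (Halt, ?t, int (length out))"
    by (rule runs_in_step) (rule runs_in_refl)
  moreover have "\<forall>i < length out. ?t (int i) = bit_cell (out ! i)" "?t (int (length out)) = blank"
    using 0(2) by auto
  ultimately show ?case unfolding diff_zero by blast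
next
  case (Suc j)
  let ?m = "length out - Suc j"
  have m: "length out - j = Suc ?m" "?m < length out" using Suc.prems(1) by auto
  let ?t = "t(int ?m := bit_cell (out ! ?m))"
  have "step (Find r q, t, int ?m) = (Find r q, ?t, int (length out - j))"
    using Suc.prems(3)[of ?m] m by (simp add: mstep_def tape_def del: of_nat_diff)
  moreover have "\<exists>t'. runs_in step (Suc j) (Find r q, ?t, int (length out - j)) (Halt, t', int (length out)) \<and>
     (\<forall>i < length out. t' (int i) = bit_cell (out ! i)) \<and> t' (int (length out)) = blank"
    by (rule Suc.IH) (use Suc.prems m in \<open>auto simp: less_Suc_eq\<close>)
  ultimately show ?case by (metis runs_in_step)
qed

theorem quadratic_time_tm:
  obtains M c where "tm_wf M"
    "\<And>w. \<exists>k \<le> c * (length w + 1) ^ 2. tm_halts_with M w k (result r w)"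
proof -
  obtain M where M: "tm_wf M"
    "\<And>w k t p out. (step ^^ k) (minit (Find 0 q0) blank bit_cell w) = (Halt, t, p) \<Longrightarrow>
       \<forall>i < length out. t (int i) = bit_cell (out ! i) \<Longrightarrow> t (int (length out)) = blank \<Longrightarrow>
       tm_halts_with M w k out"
    by (rule tm_of_machine[OF finite_states, of "Find 0 q0" Halt blank bit_cell \<delta>])
      (use \<delta>_closed in auto)
  \<comment> \<open>The result has at most r W (n + 1) bits for input length n; the summand 1 makes
    a (n + 1) bound the input as well.\<close>
  define a where "a = r * W + 1"
  have "\<exists>k \<le> (r * (4 * a + 5) + a + 1) * (length w + 1) ^ 2. tm_halts_with M w k (result r w)" for w
  proof -
    let ?n = "length w + 1" and ?out = "result r w"
    define Z where "Z = a * ?n"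
    have Z: "length w \<le> Z" "length ?out \<le> Z"
      using length_result[of r w] by (auto simp: Z_def a_def algebra_simps)
    have init: "minit (Find 0 q0) blank bit_cell w = (Find 0 q0, tape w 0 [], 0)"
      by (auto simp: minit_def tape_def fun_eq_iff)
    obtain t where t: "runs_in step (Suc (length ?out)) (Find r q0, tape w 0 ?out, 0) (Halt, t, int (length ?out))"
      "\<forall>i < length ?out. t (int i) = bit_cell (?out ! i)" "t (int (length ?out)) = blank"
      using convert_run[of "length ?out" ?out "tape w 0 ?out" w q0] by auto
    have "runs_in step (r * (Suc (length w) * (4 * Z + 5)) + Suc (length ?out))
      (Find 0 q0, tape w 0 [], 0) (Halt, t, int (length ?out))"
      by (rule runs_in_trans[OF sweeps_run t(1)]) (use Z in auto)
    moreover have "r * (Suc (length w) * (4 * Z + 5)) + Suc (length ?out) \<le> (r * (4 * a + 5) + a + 1) * ?n ^ 2"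
    proof -
      have n: "1 \<le> ?n" "?n \<le> ?n ^ 2" by (simp_all add: power2_eq_square)
      \<comment> \<open>Constants are raised to multiples of \<open>?n\<close> or its square, so
        that every term becomes quadratic.\<close>
      have "r * (Suc (length w) * (4 * Z + 5)) + Suc (length ?out) \<le> r * (?n * (4 * Z + 5 * ?n)) + (?n ^ 2 + a * ?n ^ 2)"
      proof (rule add_mono)
        have "5 * 1 \<le> 5 * ?n" by simp
        then show "r * (Suc (length w) * (4 * Z + 5)) \<le> r * (?n * (4 * Z + 5 * ?n))"
          by (intro mult_le_mono) auto
        have "Z \<le> a * ?n ^ 2" unfolding Z_def by (intro mult_le_mono n) simp
        moreover have "1 \<le> ?n ^ 2" by simp
        ultimately show "Suc (length ?out) \<le> ?n ^ 2 + a * ?n ^ 2" using Z(2) by linarith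
      qed
      also have "\<dots> = (r * (4 * a + 5) + a + 1) * ?n ^ 2"
        by (simp add: Z_def power2_eq_square algebra_simps)
      finally show ?thesis .
    qed
    ultimately obtain k where "k \<le> (r * (4 * a + 5) + a + 1) * ?n ^ 2"
      "(step ^^ k) (Find 0 q0, tape w 0 [], 0) = (Halt, t, int (length ?out))"
      unfolding runs_in_def by (meson order_trans)
    then show ?thesis using M(2) t(2,3) init by metis
  qed
  with M(1) show thesis by (rule that)
qed

end

section \<open>Transducing circuit encodings\<close>

datatype parse_state = Header | Tag1 | Tag2 bool | Arg1 | Arg2

instance parse_state :: finite
proof
  have "(UNIV :: parse_state set) = {Header, Tag1, Tag2 False, Tag2 True, Arg1, Arg2}"
    by (auto, metis (full_types) parse_state.exhaust)
  then show "finite (UNIV :: parse_state set)" by (metis finite.simps)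
qed

text \<open>\<open>Arg2\<close> reads the first of two unary arguments, \<open>Arg1\<close> the last one.\<close>
fun parse :: "parse_state \<Rightarrow> bool \<Rightarrow> parse_state" where
  "parse Header b = (if b then Header else Tag1)"
| "parse Tag1 b = Tag2 b"
| "parse (Tag2 b) b' = (if b \<or> b' then Arg2 else Arg1)"
| "parse Arg2 b = (if b then Arg2 else Arg1)"
| "parse Arg1 b = (if b then Arg1 else Tag1)"

text \<open>\<open>Shift\<close> rewrites the circuit itself. The others write the number of inputs
  or of vertices in unary without terminator, so a following \<open>enc_nat c\<close> adds c to
  it.\<close>

datatype sweep_kind = Shift | Inputs | Wires

text \<open>Prepending three ones to the terminator of a unary number adds 3 to it.\<close>
fun emit :: "sweep_kind \<Rightarrow> parse_state \<Rightarrow> bool \<Rightarrow> bool list" where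
  "emit Shift Tag1 b = [b]"
| "emit Shift (Tag2 _) b = [b]"
| "emit Shift _ b = (if b then [True] else enc_nat 3)"
| "emit Inputs Header True = [True]"
| "emit Wires Header True = [True]"
| "emit Wires Tag1 _ = [True]"
| "emit _ _ _ = []"

text \<open>The gadget is cut at its operands that depend on C: each sweep after the first starts
  with such an operand, and its tail completes it and runs up to the next. As w is the size plus 2,
  wire w + i is the size plus i + 2.\<close>

definition reduction_prog :: "(sweep_kind \<times> bool list) list" where
  "reduction_prog =
    [(Shift, [False, True] @ enc_nat 2), (Inputs, enc_nat 2 @ [True, False] @ enc_nat 2),
     (Inputs, enc_nat 2 @ [False, False]), (Wires, enc_nat 4 @ [True, False]),
     (Wires, enc_nat 3), (Wires, enc_nat 5 @ [False, True]), (Wires, enc_nat 6),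
     (Wires, enc_nat 2 @ [False, True] @ enc_nat 1), (Wires, enc_nat 7 @ [False, False]),
     (Wires, enc_nat 8 @ [False, True] @ enc_nat 0), (Wires, enc_nat 9)]"

lemma enc_nat_add: "enc_nat (a + b) = replicate a True @ enc_nat b"
  by (simp add: enc_nat_def replicate_add)

lemma foldl_parse_True: 
  "foldl parse Header (replicate n True) = Header"
  "foldl parse Arg1 (replicate n True) = Arg1"
  "foldl parse Arg2 (replicate n True) = Arg2"
  by (induction n) auto

lemma foldl_parse_enc_nat [simp]:
  "foldl parse Header (enc_nat n) = Tag1"
  "foldl parse Arg1 (enc_nat n) = Tag1"
  "foldl parse Arg2 (enc_nat n) = Arg1"
  by (simp_all add: enc_nat_def foldl_parse_True)

lemma transduce_replicate:
  "nx q b = q \<Longrightarrow> transduce nx e q (replicate n b) = concat (replicate n (e q b))"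
  by (induction n) auto

lemma concat_replicate_singleton: "concat (replicate n [b]) = replicate n b"
  by (induction n) auto

lemma transduce_enc_nat:
  assumes "q \<in> {Header, Arg1, Arg2}"
  shows "transduce parse (emit Shift) q (enc_nat n) = enc_nat (n + 3)"
    "transduce parse (emit Inputs) q (enc_nat n) = (if q = Header then replicate n True else [])"
    "transduce parse (emit Wires) q (enc_nat n) = (if q = Header then replicate n True else [])"
  using assms unfolding enc_nat_add
  by (auto simp: enc_nat_def[of n] transduce_append foldl_parse_True transduce_replicate
      concat_replicate_singleton concat_replicate_trivial)

lemma foldl_parse_enc_gate: "foldl parse Tag1 (enc_gate g) = Tag1"
  by (cases g) auto

lemma transduce_enc_gate:
  "transduce parse (emit Shift) Tag1 (enc_gate g) = enc_gate (shift_gate 3 g)"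
  "transduce parse (emit Inputs) Tag1 (enc_gate g) = []"
  "transduce parse (emit Wires) Tag1 (enc_gate g) = [True]"
  by (cases g; simp add: transduce_append transduce_enc_nat)+

lemma transduce_enc_gates:
  "transduce parse (emit Shift) Tag1 (concat (map enc_gate gs)) = concat (map (enc_gate \<circ> shift_gate 3) gs)"
  "transduce parse (emit Inputs) Tag1 (concat (map enc_gate gs)) = []"
  "transduce parse (emit Wires) Tag1 (concat (map enc_gate gs)) = replicate (length gs) True"
  by (induction gs) (simp_all add: transduce_append transduce_enc_gate foldl_parse_enc_gate)

lemma transduce_enc_circ:
  "transduce parse (emit Shift) Header (enc_circ C)
     = enc_nat (fst C + 3) @ concat (map (enc_gate \<circ> shift_gate 3) (snd C))"
  "transduce parse (emit Inputs) Header (enc_circ C) = replicate (fst C) True"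
  "transduce parse (emit Wires) Header (enc_circ C) = replicate (circ_size C) True"
  by (simp_all add: enc_circ_def circ_size_def transduce_append transduce_enc_nat transduce_enc_gates
      replicate_add)

interpretation reduction: sweeping_transducer Header parse "\<lambda>p. emit (fst (reduction_prog ! p))"
  "\<lambda>p. snd (reduction_prog ! p)" "length reduction_prog" 20
proof
  \<comment> \<open>The bound 20 is generous: emitted blocks have at most 4 bits and tails at most
    12.\<close>
  show "length (emit (fst (reduction_prog ! p)) q b) \<le> 20" for p q b
    by (cases "(fst (reduction_prog ! p), q, b)" rule: emit.cases) (auto simp: enc_nat_def)
  have "\<forall>x \<in> set reduction_prog. length (snd x) \<le> 20"
    by (simp add: reduction_prog_def enc_nat_def)
  then show "length (snd (reduction_prog ! p)) \<le> 20" if "p < length reduction_prog" for p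
    using that nth_mem by blast
qed

lemma reduction_output:
  "reduction.result (length reduction_prog) (enc_circ C) = enc_circ (reduce_circ C)"
proof -
  have "reduction.result (length reduction_prog) (enc_circ C)
      = concat (map (\<lambda>(k, ws). transduce parse (emit k) Header (enc_circ C) @ ws) reduction_prog)"
  proof -
    have "map (\<lambda>p. reduction.sweep p (enc_circ C)) [0..<length reduction_prog]
        = map (\<lambda>(k, ws). transduce parse (emit k) Header (enc_circ C) @ ws) reduction_prog"
      by (rule nth_equalityI) (auto simp: reduction.sweep_def split: prod.split)
    then show ?thesis by (simp only: reduction.result_def)
  qed
  also have "\<dots> = enc_circ (reduce_circ C)"
  proof -
    have "enc_circ (reduce_circ C) = enc_nat (fst C + 3) @ concat (map (enc_gate \<circ> shift_gate 3) (snd C))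
        @ concat (map enc_gate (gadget (fst C + 2) (circ_size C + 2)))"
      by (simp add: enc_circ_def reduce_circ_def)
    then show ?thesis
      by (simp add: reduction_prog_def transduce_enc_circ gadget_def enc_nat_def numeral_eq_Suc
          replicate_app_Cons_same)
  qed
  finally show ?thesis .
qed

theorem theorem2:
  shows "poly_karp_reducible circ_wf circ_satisfiable enc_circ
           circ_wf circ_fsr_indecomposable enc_circ"
proof -
  obtain M c where M: "tm_wf M"
    "\<And>w. \<exists>k \<le> c * (length w + 1) ^ 2. tm_halts_with M w k (reduction.result (length reduction_prog) w)"
    by (rule reduction.quadratic_time_tm) (rule that)
  have "circ_wf C \<Longrightarrow> circ_wf (reduce_circ C) \<and>
      (\<exists>k \<le> c * (length (enc_circ C) + 1) ^ 2. tm_halts_with M (enc_circ C) k (enc_circ (reduce_circ C))) \<and>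
      (circ_satisfiable C \<longleftrightarrow> circ_fsr_indecomposable (reduce_circ C))" for C
    using circ_wf_reduce satisfiable_iff_indecomposable_reduce M(2)[of "enc_circ C"]
    by (simp only: reduction_output)
  with M(1) show ?thesis unfolding poly_karp_reducible_def by blast
qed

end
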